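(* Let $p_1,\ldots,p_n$ be relatively prime positive integers, let $p=(p_1,\ldots,p_n)$, and let $G$ be a Gröbner basis of the lattice ideal $I_{\mathcal L}$ with respect to the term order $\leq$ defined in the context. Let $M_p$ be the set of all vectors $c\in\mathbb{Z}^n$ such that (M1) $c_1=-1$ and $c_i\geq 0$ for $i=2,\ldots,n$; (M2) $x^{c^+}$ cannot be reduced by any element of $G$; (M3) for each $i=2,\ldots,n$, $x^{(c+e_i)^+}$ can be reduced by some $g_i\in G$. Then the set $M':=\{(a_1+1,\ldots,a_n+1) \mid a\in M_p\}$ is the irredundant irreducible decomposition of the initial ideal $\mathrm{in}_\leq(I_{\mathcal L})$.
   Context: $\mathbb{N}$ includes $0$. "Relatively prime" means $\gcd(p_1,\ldots,p_n)=1$ (not necessarily pairwise coprime). The $p$-degree of $v\in\mathbb{Z}^n$ is $v\cdot p$. $e_i\in\mathbb{N}^n$ is the $i$-th standard basis vector. For $v\in\mathbb{Z}^n$, $v^+\in\mathbb{N}^n$ is given by $v^+_i=\max(v_i,0)$ and $v^-:=(-v)^+$. For $v\in\mathbb{N}^n$, $x^v=x_1^{v_1}\cdots x_n^{v_n}$ in the polynomial ring $k[x_1,\ldots,x_n]$ over a field $k$. The lattice ideal is $I_{\mathcal L}=\langle x^{v^+}-x^{v^-} \mid v\in\mathbb{Z}^n,\ v\cdot p=0\rangle$. The term order $\leq$ first compares the $p$-degree of exponent vectors, and breaks ties by the reverse lexicographic order with $x_1<x_2<\cdots<x_n$: if $u\ne v$ have equal $p$-degree, then $x^u<x^v$ iff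 $u_i>v_i$ for the smallest index $i$ with $u_i\neq v_i$. A monomial $x^m$ can be reduced by $g$ if the initial monomial $\mathrm{in}_\leq(g)$ divides $x^m$. For $v\in\mathbb{N}^n$ let $\phi(v)=\langle x_i^{v_i} \mid v_i>0\rangle$; ideals of this form are called irreducible. The irredundant irreducible decomposition of a monomial ideal $I$ is the unique minimal (finite) subset $D\subseteq\mathbb{N}^n$ such that $I=\bigcap_{v\in D}\phi(v)$; e.g. for $I=\langle x_1^2,x_1x_2\rangle=\langle x_1\rangle\cap\langle x_1^2,x_2\rangle$ it is $\{(1,0),(2,1)\}$. *)

theory Defs
  imports "HOL-Analysis.Finite_Cartesian_Product" "HOL-Library.Poly_Mapping"
begin

(* The index set {1,...,n} is a finite linearly ordered type 'n, so Z^n is int^'n and N^n is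
   nat^'n. The ring k[x_1,...,x_n] is the monoid algebra of (N^n, +) over k, i.e. the finitely
   supported maps from exponent vectors to k with the convolution product of Poly_Mapping. *)

type_synonym ('n, 'k) mpoly = "(nat ^ 'n) \<Rightarrow>\<^sub>0 'k"

(* The index 1. *)
definition first_index :: "'n::{finite,linorder}"
  where "first_index = Min UNIV"

definition p_degree :: "nat ^ 'n \<Rightarrow> int ^ 'n \<Rightarrow> int"
  where "p_degree p v = (\<Sum>i\<in>UNIV. v $ i * int (p $ i))"

definition int_vec :: "nat ^ 'n \<Rightarrow> int ^ 'n"
  where "int_vec u = (\<chi> i. int (u $ i))"

definition pos_part :: "int ^ 'n \<Rightarrow> nat ^ 'n"
  where "pos_part v = (\<chi> i. nat (max (v $ i) 0))"

definition neg_part :: "int ^ 'n \<Rightarrow> nat ^ 'n"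
  where "neg_part v = pos_part (- v)"

(* The monomial x^v. *)
definition monomial :: "nat ^ 'n \<Rightarrow> ('n, 'k::field) mpoly"
  where "monomial v = Poly_Mapping.single v 1"

(* A commutative ring as a module over itself: its submodules are its ideals, and the span of a
   set is the ideal generated by it. *)
lemma module_mult: "module ((*) :: 'a::comm_ring_1 \<Rightarrow> 'a \<Rightarrow> 'a)"
  by unfold_locales (simp_all add: algebra_simps)

definition ideal_generated :: "'a::comm_ring_1 set \<Rightarrow> 'a set"
  where "ideal_generated B = module.span (*) B"

definition lattice_ideal :: "nat ^ 'n \<Rightarrow> ('n, 'k::field) mpoly set"
  where "lattice_ideal p =
    ideal_generated {monomial (pos_part v) - monomial (neg_part v) | v. p_degree p v = 0}"

definition term_less :: "nat ^ 'n::{finite,linorder} \<Rightarrow> nat ^ 'n::{finite,linorder} \<Rightarrow> nat ^ 'n::{finite,linorder} \<Rightarrow> bool"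
  where "term_less p u v \<longleftrightarrow>
    p_degree p (int_vec u) < p_degree p (int_vec v) \<or>
    (p_degree p (int_vec u) = p_degree p (int_vec v) \<and>
      (\<exists>i. u $ i > v $ i \<and> (\<forall>j<i. u $ j = v $ j)))"

(* Exponent vector of the initial monomial; meaningful only for nonzero f. *)
definition initial_exponent :: "nat ^ 'n::{finite,linorder} \<Rightarrow> ('n, 'k::field) mpoly \<Rightarrow> nat ^ 'n::{finite,linorder}"
  where "initial_exponent p f =
    (THE m. m \<in> Poly_Mapping.keys f \<and>
      (\<forall>u\<in>Poly_Mapping.keys f. u \<noteq> m \<longrightarrow> term_less p u m))"

definition initial_monomial ::
    "nat ^ 'n::{finite,linorder} \<Rightarrow> ('n, 'k::field) mpoly \<Rightarrow> ('n, 'k) mpoly"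
  where "initial_monomial p f = monomial (initial_exponent p f)"

definition initial_ideal ::
    "nat ^ 'n::{finite,linorder} \<Rightarrow> ('n, 'k::field) mpoly set \<Rightarrow> ('n, 'k) mpoly set"
  where "initial_ideal p I = ideal_generated {initial_monomial p f | f. f \<in> I \<and> f \<noteq> 0}"

(* A member 0 of G is tolerated and contributes nothing. *)
definition groebner_basis ::
    "nat ^ 'n::{finite,linorder} \<Rightarrow> ('n, 'k::field) mpoly set \<Rightarrow> ('n, 'k) mpoly set \<Rightarrow> bool"
  where "groebner_basis p G I \<longleftrightarrow>
    finite G \<and> G \<subseteq> I \<and>
    ideal_generated {initial_monomial p g | g. g \<in> G \<and> g \<noteq> 0} = initial_ideal p I"

(* The zero polynomial has no initial monomial and reduces nothing. *)
definition reducible_by ::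
    "nat ^ 'n::{finite,linorder} \<Rightarrow> nat ^ 'n::{finite,linorder} \<Rightarrow> ('n, 'k::field) mpoly \<Rightarrow> bool"
  where "reducible_by p m g \<longleftrightarrow> g \<noteq> 0 \<and> initial_monomial p g dvd monomial m"

(* axis i (v $ i) is v_i e_i, so the generators are the powers x_i^{v_i}. *)
definition irreducible_ideal :: "nat ^ 'n \<Rightarrow> ('n, 'k::field) mpoly set"
  where "irreducible_ideal v = ideal_generated {monomial (axis i (v $ i)) | i. v $ i > 0}"

definition irreducible_decomposition ::
    "('n, 'k::field) mpoly set \<Rightarrow> (nat ^ 'n) set \<Rightarrow> bool"
  where "irreducible_decomposition I D \<longleftrightarrow> finite D \<and> I = (\<Inter>v\<in>D. irreducible_ideal v)"

definition minimal_irreducible_decomposition ::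
    "('n, 'k::field) mpoly set \<Rightarrow> (nat ^ 'n) set \<Rightarrow> bool"
  where "minimal_irreducible_decomposition I D \<longleftrightarrow>
    irreducible_decomposition I D \<and> (\<forall>E. E \<subset> D \<longrightarrow> \<not> irreducible_decomposition I E)"

(* D is the unique minimal decomposition: uniqueness is part of the claim. *)
definition irredundant_irreducible_decomposition ::
    "('n, 'k::field) mpoly set \<Rightarrow> (nat ^ 'n) set \<Rightarrow> bool"
  where "irredundant_irreducible_decomposition I D \<longleftrightarrow>
    minimal_irreducible_decomposition I D \<and>
    (\<forall>E. minimal_irreducible_decomposition I E \<longrightarrow> E = D)"

definition M_set ::
    "nat ^ 'n::{finite,linorder} \<Rightarrow> ('n, 'k::field) mpoly set \<Rightarrow> (int ^ 'n::{finite,linorder}) set"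
  where "M_set p G = {c.
    (c $ first_index = -1 \<and> (\<forall>i. i \<noteq> first_index \<longrightarrow> c $ i \<ge> 0)) \<and>
    (\<forall>g\<in>G. \<not> reducible_by p (pos_part c) g) \<and>
    (\<forall>i. i \<noteq> first_index \<longrightarrow> (\<exists>g\<in>G. reducible_by p (pos_part (c + axis i 1)) g))}"

(* On M_set all entries are at least -1, so the conversion to nat does not truncate. *)
definition add_ones :: "int ^ 'n \<Rightarrow> nat ^ 'n"
  where "add_ones a = (\<chi> i. nat (a $ i + 1))"

end

(* Every element of the lattice ideal has coefficient sum zero on each p-degree, so its initial
   exponent is never the smallest vector of its p-degree; conversely x^m - x^u lies in the ideal
   whenever u and m have equal p-degree. Hence the initial ideal is spanned by the monomials x^m
   with m not smallest in its p-degree. As x_1 is the cheapest variable, this set of exponents does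
   not depend on m_1, and it contains a power of every other variable. So the exponents outside it
   are those lying, off the first coordinate, below one of finitely many maximal ones w, and
   "not below w" is membership in the irreducible ideal of w + 1. These w form an antichain, and
   since an irreducible ideal containing a finite intersection of irreducible ideals contains one
   of them, an antichain decomposition is contained in every decomposition. *)

theory Submission
  imports Defs
begin

subsection \<open>Monomial ideals\<close>

interpretation mult_module: module "(*) :: 'a::comm_ring_1 \<Rightarrow> 'a \<Rightarrow> 'a"
  by (rule module_mult)

lemma monomial_mult [simp]: "monomial u * monomial v = monomial (u + v)"
  by (simp add: monomial_def mult_single)

lemma keys_monomial [simp]: "Poly_Mapping.keys (monomial v :: ('n::finite, 'k::field) mpoly) = {v}"
  by (simp add: monomial_def)

lemma poly_mapping_eq_sum_single:
  "f = (\<Sum>k\<in>Poly_Mapping.keys f. Poly_Mapping.single k (Poly_Mapping.lookup f k))"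
proof (rule poly_mapping_eqI)
  fix k
  show "Poly_Mapping.lookup f k = Poly_Mapping.lookup
    (\<Sum>k\<in>Poly_Mapping.keys f. Poly_Mapping.single k (Poly_Mapping.lookup f k)) k"
    by (cases "k \<in> Poly_Mapping.keys f")
      (auto simp: lookup_sum lookup_single when_def not_in_keys_iff_lookup_eq_zero)
qed

text \<open>The exponent condition survives sums and multiples, so it cuts out an ideal containing
  the generators; conversely, each term of such an \<open>f\<close> is a multiple of a generator.
  Ideal membership thus becomes a question about exponents alone.\<close>

lemma monomial_ideal_iff:
  fixes f :: "('n::finite, 'k::field) mpoly"
  shows "f \<in> ideal_generated (monomial ` S) \<longleftrightarrow> (\<forall>k\<in>Poly_Mapping.keys f. \<exists>s\<in>S. s \<le> k)"
proof
  let ?K = "{f :: ('n, 'k) mpoly. \<forall>k\<in>Poly_Mapping.keys f. \<exists>s\<in>S. s \<le> k}"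
  assume f: "f \<in> ideal_generated (monomial ` S)"
  have "mult_module.subspace ?K"
  proof (rule mult_module.subspaceI)
    show "f + g \<in> ?K" if "f \<in> ?K" "g \<in> ?K" for f g
      using that keys_add[of f g] by blast
    show "c * f \<in> ?K" if f: "f \<in> ?K" for c f
    proof (rule CollectI, rule ballI)
      fix k assume "k \<in> Poly_Mapping.keys (c * f)"
      then obtain a b where b: "b \<in> Poly_Mapping.keys f" and k: "k = a + b"
        using keys_mult[of c f] by fast
      from f b obtain s where s: "s \<in> S" "s \<le> b" by fast
      have "s \<le> k" unfolding k less_eq_vec_def
      proof
        fix i
        from s(2) have "s $ i \<le> b $ i" by (simp add: less_eq_vec_def)
        then show "s $ i \<le> (a + b) $ i" by simp
      qed
      with s(1) show "\<exists>s\<in>S. s \<le> k" by (rule bexI[rotated])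
    qed
  qed simp
  moreover have "monomial ` S \<subseteq> ?K" by auto
  ultimately have "ideal_generated (monomial ` S) \<subseteq> ?K"
    unfolding ideal_generated_def by (rule mult_module.span_minimal[rotated])
  with f show "\<forall>k\<in>Poly_Mapping.keys f. \<exists>s\<in>S. s \<le> k" by fast
next
  assume S: "\<forall>k\<in>Poly_Mapping.keys f. \<exists>s\<in>S. s \<le> k"
  have "Poly_Mapping.single k c \<in> ideal_generated (monomial ` S)"
    if k: "k \<in> Poly_Mapping.keys f" for k c
  proof -
    obtain s where s: "s \<in> S" "s \<le> k" using S k by fast
    \<comment> \<open>Subtraction on \<open>nat\<close> truncates; it is exact here because
      \<open>s \<le> k\<close>.\<close>
    then have "(k - s) + s = k" by (simp add: less_eq_vec_def vec_eq_iff)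
    then have "Poly_Mapping.single k c = Poly_Mapping.single (k - s) c * monomial s"
      by (simp add: monomial_def mult_single)
    with s show ?thesis
      by (simp add: ideal_generated_def mult_module.span_scale mult_module.span_base)
  qed
  then show "f \<in> ideal_generated (monomial ` S)"
    by (subst poly_mapping_eq_sum_single)
      (auto simp: ideal_generated_def intro: mult_module.span_sum)
qed

lemma monomial_in_ideal_iff:
  "(monomial m :: ('n::finite, 'k::field) mpoly) \<in> ideal_generated (monomial ` S) \<longleftrightarrow> (\<exists>s\<in>S. s \<le> m)"
  by (simp add: monomial_ideal_iff)

lemma monomial_dvd_iff:
  "(monomial u :: ('n::finite, 'k::field) mpoly) dvd monomial v \<longleftrightarrow> u \<le> v"
proof
  assume "(monomial u :: ('n::finite, 'k::field) mpoly) dvd monomial v"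
  then obtain q :: "('n, 'k) mpoly" where "monomial v = q * monomial u"
    by (auto simp: dvd_def mult.commute)
  then have "(monomial v :: ('n, 'k) mpoly) \<in> ideal_generated (monomial ` {u})"
    by (auto simp: ideal_generated_def intro: mult_module.span_scale mult_module.span_base)
  then show "u \<le> v" by (simp only: monomial_in_ideal_iff) simp
next
  assume "u \<le> v"
  then have "u + (v - u) = v" by (simp add: less_eq_vec_def vec_eq_iff)
  then show "(monomial u :: ('n, 'k) mpoly) dvd monomial v"
    by (metis dvd_triv_left monomial_mult)
qed

section \<open>Irreducible ideals and irredundancy of decompositions\<close>

definition in_irreducible :: "nat ^ 'n \<Rightarrow> nat ^ 'n \<Rightarrow> bool"
  where "in_irreducible v m \<longleftrightarrow> (\<exists>i. 0 < v $ i \<and> v $ i \<le> m $ i)"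

lemma axis_le_iff: "axis i (a :: nat) \<le> m \<longleftrightarrow> a \<le> m $ i"
  by (auto simp: less_eq_vec_def axis_def)

lemma irreducible_ideal_iff:
  "(f :: ('n::finite, 'k::field) mpoly) \<in> irreducible_ideal v \<longleftrightarrow>
    (\<forall>k\<in>Poly_Mapping.keys f. in_irreducible v k)"
proof -
  have "{monomial (axis i (v $ i)) | i. v $ i > 0} =
      (monomial :: _ \<Rightarrow> ('n, 'k) mpoly) ` ((\<lambda>i. axis i (v $ i)) ` {i. v $ i > 0})"
    by auto
  then show ?thesis
    unfolding irreducible_ideal_def
    by (auto simp: monomial_ideal_iff in_irreducible_def axis_le_iff)
qed

text \<open>It suffices to test the pure powers generating the smaller ideal: a power of one
  variable can only be divisible by a generator in that same variable.\<close>

lemma irreducible_ideal_subset_iff: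
  "(irreducible_ideal v :: ('n::finite, 'k::field) mpoly set) \<subseteq> irreducible_ideal w \<longleftrightarrow>
    (\<forall>i. 0 < v $ i \<longrightarrow> 0 < w $ i \<and> w $ i \<le> v $ i)"
proof
  assume sub: "(irreducible_ideal v :: ('n, 'k) mpoly set) \<subseteq> irreducible_ideal w"
  show "\<forall>i. 0 < v $ i \<longrightarrow> 0 < w $ i \<and> w $ i \<le> v $ i"
  proof (intro allI impI)
    fix i assume "0 < v $ i"
    then have "(monomial (axis i (v $ i)) :: ('n, 'k) mpoly) \<in> irreducible_ideal v"
      by (auto simp: irreducible_ideal_iff in_irreducible_def intro!: exI[of _ i])
    from subsetD[OF sub this] have "in_irreducible w (axis i (v $ i))"
      by (simp add: irreducible_ideal_iff)
    then obtain j where "0 < w $ j" "w $ j \<le> axis i (v $ i) $ j"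
      by (auto simp: in_irreducible_def)
    then show "0 < w $ i \<and> w $ i \<le> v $ i"
      by (cases "i = j") (auto simp: axis_def)
  qed
next
  assume "\<forall>i. 0 < v $ i \<longrightarrow> 0 < w $ i \<and> w $ i \<le> v $ i"
  then have "in_irreducible w k" if "in_irreducible v k" for k
    using that unfolding in_irreducible_def by (meson order_trans)
  then show "(irreducible_ideal v :: ('n, 'k) mpoly set) \<subseteq> irreducible_ideal w"
    by (auto simp: irreducible_ideal_iff)
qed

lemma irreducible_ideal_inject:
  assumes "(irreducible_ideal v :: ('n::finite, 'k::field) mpoly set) = irreducible_ideal w"
  shows "v = w"
  unfolding vec_eq_iff
proof
  fix i
  have "\<forall>i. 0 < v $ i \<longrightarrow> 0 < w $ i \<and> w $ i \<le> v $ i"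
    "\<forall>i. 0 < w $ i \<longrightarrow> 0 < v $ i \<and> v $ i \<le> w $ i"
    unfolding irreducible_ideal_subset_iff[where ?'k = 'k, symmetric] using assms by blast+
  then have "0 < v $ i \<longrightarrow> 0 < w $ i \<and> w $ i \<le> v $ i" "0 < w $ i \<longrightarrow> 0 < v $ i \<and> v $ i \<le> w $ i"
    by blast+
  then show "v $ i = w $ i" by linarith
qed

text \<open>If every member of \<open>E\<close> had a generator outside \<open>irreducible_ideal w\<close>, the least common
  multiple of these pure powers would lie in the intersection but not in \<open>irreducible_ideal w\<close>.\<close>

lemma irreducible_ideal_prime:
  assumes "finite E"
    and sub: "(\<Inter>v\<in>E. irreducible_ideal v) \<subseteq> (irreducible_ideal w :: ('n::finite, 'k::field) mpoly set)"
  shows "\<exists>v\<in>E. (irreducible_ideal v :: ('n, 'k) mpoly set) \<subseteq> irreducible_ideal w"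
proof (rule ccontr)
  assume "\<not> ?thesis"
  then have "\<forall>v\<in>E. \<exists>i. 0 < v $ i \<and> \<not> (0 < w $ i \<and> w $ i \<le> v $ i)"
    unfolding irreducible_ideal_subset_iff by blast
  then obtain h where h: "\<And>v. v \<in> E \<Longrightarrow> 0 < v $ h v \<and> \<not> (0 < w $ h v \<and> w $ h v \<le> v $ h v)"
    by metis
  \<comment> \<open>The inserted 0 is the value of \<open>Max\<close> at indices chosen by no
    \<open>v\<close>. Since \<open>0 < w $ i \<le> m $ i\<close> below, it cannot be the maximum
    there, so some \<open>v\<close> with \<open>h v = i\<close> attains it.\<close>
  define m :: "nat ^ 'n" where "m = (\<chi> i. Max (insert 0 ((\<lambda>v. v $ i) ` {v\<in>E. h v = i})))"
  have "in_irreducible v m" if "v \<in> E" for v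
    using h[OF that] that \<open>finite E\<close>
    by (auto simp: in_irreducible_def m_def intro!: exI[of _ "h v"] Max_ge)
  then have "(monomial m :: ('n, 'k) mpoly) \<in> (\<Inter>v\<in>E. irreducible_ideal v)"
    by (simp add: irreducible_ideal_iff)
  from subsetD[OF sub this] have "(monomial m :: ('n, 'k) mpoly) \<in> irreducible_ideal w" .
  then obtain i where i: "0 < w $ i" "w $ i \<le> m $ i"
    by (auto simp: irreducible_ideal_iff in_irreducible_def)
  have "m $ i \<in> insert 0 ((\<lambda>v. v $ i) ` {v\<in>E. h v = i})"
    unfolding m_def vec_lambda_beta using \<open>finite E\<close> by (intro Max_in) auto
  with i obtain v where "v \<in> E" "h v = i" "m $ i = v $ i" by auto
  with h[of v] i show False by simp
qed

text \<open>Primality is applied twice: the ideal of \<open>w\<close> in \<open>D\<close> contains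
  that of some \<open>v\<close> in \<open>E\<close>, which contains that of some \<open>w'\<close>
  in \<open>D\<close>. The antichain condition gives \<open>w' = w\<close>, hence
  \<open>v = w\<close>. That \<open>D\<close> lies in every decomposition yields both minimality and
  uniqueness.\<close>

lemma antichain_decomposition_irredundant:
  fixes I :: "('n::finite, 'k::field) mpoly set"
  assumes D: "irreducible_decomposition I D"
    and antichain: "\<And>v w. v \<in> D \<Longrightarrow> w \<in> D \<Longrightarrow>
      (irreducible_ideal v :: ('n, 'k) mpoly set) \<subseteq> irreducible_ideal w \<Longrightarrow> v = w"
  shows "irredundant_irreducible_decomposition I D"
proof -
  have least: "D \<subseteq> E" if E: "irreducible_decomposition I E" for E
  proof
    fix w assume "w \<in> D"
    then have "I \<subseteq> irreducible_ideal w"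
      using D by (auto simp: irreducible_decomposition_def)
    with E obtain v where v: "v \<in> E" "(irreducible_ideal v :: ('n, 'k) mpoly set) \<subseteq> irreducible_ideal w"
      using irreducible_ideal_prime[of E w] by (auto simp: irreducible_decomposition_def)
    then have "I \<subseteq> irreducible_ideal v"
      using E by (auto simp: irreducible_decomposition_def)
    with D obtain w' where w': "w' \<in> D" "(irreducible_ideal w' :: ('n, 'k) mpoly set) \<subseteq> irreducible_ideal v"
      using irreducible_ideal_prime[of D v] by (auto simp: irreducible_decomposition_def)
    then have "w' = w" using antichain \<open>w \<in> D\<close> v by blast
    with v w' have "v = w" using irreducible_ideal_inject by blast
    with v show "w \<in> E" by simp
  qed
  show ?thesis
    unfolding irredundant_irreducible_decomposition_def minimal_irreducible_decomposition_def
    using D least by blast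
qed

subsection \<open>The term order and the initial ideal\<close>

lemma p_degree_add [simp]: "p_degree p (u + v) = p_degree p u + p_degree p v"
  by (simp add: p_degree_def algebra_simps sum.distrib)

lemma p_degree_diff [simp]: "p_degree p (u - v) = p_degree p u - p_degree p v"
  by (simp add: p_degree_def algebra_simps sum_subtractf)

lemma int_vec_add [simp]: "int_vec (u + v) = int_vec u + int_vec v"
  by (simp add: int_vec_def vec_eq_iff)

lemma term_less_trans:
  assumes uv: "term_less p u v" and vw: "term_less p v w"
  shows "term_less p u w"
proof (cases "p_degree p (int_vec u) = p_degree p (int_vec v) \<and>
    p_degree p (int_vec v) = p_degree p (int_vec w)")
  case True
  with uv obtain a where a: "u $ a > v $ a" "\<forall>j<a. u $ j = v $ j"
    by (auto simp: term_less_def)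
  from True vw obtain b where b: "v $ b > w $ b" "\<forall>j<b. v $ j = w $ j"
    by (auto simp: term_less_def)
  \<comment> \<open>The earlier of the two deciding indices decides between \<open>u\<close> and
    \<open>w\<close>.\<close>
  have "u $ min a b > w $ min a b"
    using a b by (cases a b rule: linorder_cases) (auto simp: min_def)
  moreover have "\<forall>j<min a b. u $ j = w $ j" using a b by simp
  ultimately show ?thesis using True unfolding term_less_def by auto
next
  case False
  with uv vw show ?thesis unfolding term_less_def by linarith
qed

lemma term_less_irrefl: "\<not> term_less p u u"
  by (simp add: term_less_def)

lemma term_less_total:
  assumes "u \<noteq> v"
  shows "term_less p u v \<or> term_less p v u"
proof -
  define i where "i = Min {i. u $ i \<noteq> v $ i}"
  have ne: "{i. u $ i \<noteq> v $ i} \<noteq> {}" using assms by (auto simp: vec_eq_iff)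
  have "u $ i \<noteq> v $ i" using Min_in[OF _ ne] by (auto simp: i_def)
  moreover have "u $ j = v $ j" if "j < i" for j
  proof (rule ccontr)
    assume "u $ j \<noteq> v $ j"
    then have "i \<le> j" unfolding i_def by (intro Min_le) auto
    with that show False by simp
  qed
  ultimately show ?thesis
    unfolding term_less_def by (metis linorder_neqE)
qed

text \<open>A finite nonempty set has a greatest element for a total transitive relation, and
  irreflexivity makes it unique; so the definite description in \<open>initial_exponent\<close>
  denotes.\<close>

lemma initial_exponent:
  fixes f :: "('n::{finite,linorder}, 'k::field) mpoly"
  assumes "f \<noteq> 0"
  shows "initial_exponent p f \<in> Poly_Mapping.keys f"
    and "\<And>u. u \<in> Poly_Mapping.keys f \<Longrightarrow> u \<noteq> initial_exponent p f \<Longrightarrow> term_less p u (initial_exponent p f)"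
proof -
  have ex: "\<exists>m\<in>A. \<forall>u\<in>A. u \<noteq> m \<longrightarrow> term_less p u m" if "finite A" "A \<noteq> {}" for A
    using that
  proof (induction rule: finite_ne_induct)
    case (insert x A)
    then obtain m where m: "m \<in> A" "\<forall>u\<in>A. u \<noteq> m \<longrightarrow> term_less p u m" by blast
    show ?case
    proof (cases "term_less p x m")
      case True
      with m show ?thesis by blast
    next
      case False
      moreover have "m \<noteq> x" using m(1) insert.hyps by blast
      ultimately have "term_less p m x" using term_less_total by blast
      then have "term_less p u x" if "u \<in> A" for u
        using m that term_less_trans[of p u m x] by (cases "u = m") auto
      then show ?thesis by blast
    qed
  qed auto
  have "\<exists>m\<in>Poly_Mapping.keys f. \<forall>u\<in>Poly_Mapping.keys f. u \<noteq> m \<longrightarrow> term_less p u m"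
    using assms by (intro ex) auto
  then have "\<exists>!m. m \<in> Poly_Mapping.keys f \<and> (\<forall>u\<in>Poly_Mapping.keys f. u \<noteq> m \<longrightarrow> term_less p u m)"
    by (metis term_less_trans term_less_irrefl)
  from theI'[OF this] show "initial_exponent p f \<in> Poly_Mapping.keys f"
    and "\<And>u. u \<in> Poly_Mapping.keys f \<Longrightarrow> u \<noteq> initial_exponent p f \<Longrightarrow> term_less p u (initial_exponent p f)"
    unfolding initial_exponent_def by auto
qed

text \<open>These turn out to be the exponents of the monomials in the initial ideal; the
  description involves neither the field nor \<open>G\<close>.\<close>

definition nonminimal :: "nat ^ 'n::{finite,linorder} \<Rightarrow> (nat ^ 'n::{finite,linorder}) set"
  where "nonminimal p =
    {m. \<exists>u. p_degree p (int_vec u) = p_degree p (int_vec m) \<and> term_less p u m}"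

lemma nonminimal_iff:
  "m \<in> nonminimal p \<longleftrightarrow> (\<exists>u. p_degree p (int_vec u) = p_degree p (int_vec m) \<and>
    (\<exists>i. u $ i > m $ i \<and> (\<forall>j<i. u $ j = m $ j)))"
  by (auto simp: nonminimal_def term_less_def)

text \<open>Adding \<open>k - m\<close> to both \<open>u\<close> and \<open>m\<close> preserves
  equality of degrees and the deciding index.\<close>

lemma nonminimal_upward:
  assumes "m \<in> nonminimal p" "m \<le> k"
  shows "k \<in> nonminimal p"
proof -
  from assms obtain u i where u: "p_degree p (int_vec u) = p_degree p (int_vec m)"
    "u $ i > m $ i" "\<forall>j<i. u $ j = m $ j" by (auto simp: nonminimal_iff)
  have k: "k = m + (k - m)" using assms by (simp add: less_eq_vec_def vec_eq_iff)
  have "p_degree p (int_vec (u + (k - m))) = p_degree p (int_vec (m + (k - m)))"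
    using u by simp
  moreover have "(u + (k - m)) $ i > (m + (k - m)) $ i"
    "\<forall>j<i. (u + (k - m)) $ j = (m + (k - m)) $ j" using u by auto
  ultimately show ?thesis
    using k unfolding nonminimal_iff by metis
qed

text \<open>This is the coefficient of \<open>t^d\<close> after substituting
  \<open>t^(p $ i)\<close> for each variable \<open>x_i\<close>.\<close>

definition degree_sum :: "nat ^ 'n \<Rightarrow> int \<Rightarrow> ('n::finite, 'k::field) mpoly \<Rightarrow> 'k"
  where "degree_sum p d f =
    (\<Sum>k\<in>Poly_Mapping.keys f. if p_degree p (int_vec k) = d then Poly_Mapping.lookup f k else 0)"

lemma degree_sum_superset:
  assumes "finite A" "Poly_Mapping.keys f \<subseteq> A"
  shows "degree_sum p d f = (\<Sum>k\<in>A. if p_degree p (int_vec k) = d then Poly_Mapping.lookup f k else 0)"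
  unfolding degree_sum_def using assms
  by (intro sum.mono_neutral_left) (auto simp: not_in_keys_iff_lookup_eq_zero)

lemma degree_sum_add: "degree_sum p d (f + g) = degree_sum p d f + degree_sum p d g"
proof -
  let ?A = "Poly_Mapping.keys f \<union> Poly_Mapping.keys g"
  show ?thesis
    using keys_add[of f g]
    by (simp add: degree_sum_superset[of ?A] flip: sum.distrib)
      (auto simp: lookup_add intro!: sum.cong)
qed

lemma degree_sum_zero [simp]: "degree_sum p d 0 = 0"
  by (simp add: degree_sum_def)

lemma degree_sum_single [simp]:
  "degree_sum p d (Poly_Mapping.single k c) = (if p_degree p (int_vec k) = d then c else 0)"
  by (simp add: degree_sum_superset[of "{k}"])

lemma degree_sum_sum: "degree_sum p d (sum f A) = (\<Sum>a\<in>A. degree_sum p d (f a))"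
  by (induction A rule: infinite_finite_induct) (simp_all add: degree_sum_add)

lemma degree_sum_minus: "degree_sum p d (f - g) = degree_sum p d f - degree_sum p d g"
  using degree_sum_add[of p d "f - g" g] by simp

section \<open>Initial exponents of the lattice ideal\<close>

lemma int_vec_pos_part_diff_neg_part: "int_vec (pos_part v) - int_vec (neg_part v) = v"
  by (simp add: int_vec_def pos_part_def neg_part_def vec_eq_iff max_def)

lemma degree_sum_lattice_ideal:
  fixes f :: "('n::finite, 'k::field) mpoly"
  assumes "f \<in> lattice_ideal p"
  shows "degree_sum p d f = 0"
  using assms unfolding lattice_ideal_def ideal_generated_def
proof (induction rule: mult_module.span_induct_alt)
  case (step c x y)
  from step.hyps obtain v where v: "p_degree p v = 0"
    and x: "x = monomial (pos_part v) - monomial (neg_part v)" by blast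
  have eq: "p_degree p (int_vec (pos_part v)) = p_degree p (int_vec (neg_part v))"
    using v p_degree_diff[of p "int_vec (pos_part v)" "int_vec (neg_part v)"]
    by (simp add: int_vec_pos_part_diff_neg_part del: p_degree_diff)
  \<comment> \<open>The multiplier \<open>c\<close> is an arbitrary polynomial, so it is split into
    terms; each term times the binomial has two monomials of equal degree and opposite
    coefficients.\<close>
  have "c * x = (\<Sum>k\<in>Poly_Mapping.keys c.
      Poly_Mapping.single (k + pos_part v) (Poly_Mapping.lookup c k) -
      Poly_Mapping.single (k + neg_part v) (Poly_Mapping.lookup c k))"
    by (subst poly_mapping_eq_sum_single[of c])
      (simp add: x monomial_def sum_distrib_right right_diff_distrib mult_single sum_subtractf)
  then have "degree_sum p d (c * x) = 0"
    by (simp add: degree_sum_sum degree_sum_minus eq)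
  with step.IH show ?case by (simp add: degree_sum_add)
qed simp

lemma binomial_in_lattice_ideal:
  assumes "p_degree p (int_vec u) = p_degree p (int_vec m)"
  shows "(monomial m - monomial u :: ('n::finite, 'k::field) mpoly) \<in> lattice_ideal p"
proof -
  define v where "v = int_vec m - int_vec u"
  \<comment> \<open>The exponent of the gcd of the two monomials; factoring it out leaves a
    generator of the lattice ideal.\<close>
  define w :: "nat ^ 'n" where "w = (\<chi> i. min (m $ i) (u $ i))"
  have "w + pos_part v = m" "w + neg_part v = u"
    by (auto simp: vec_eq_iff w_def v_def pos_part_def neg_part_def int_vec_def)
  then have eq: "(monomial m - monomial u :: ('n, 'k) mpoly) =
      monomial w * (monomial (pos_part v) - monomial (neg_part v))"
    by (simp add: right_diff_distrib)
  have "p_degree p v = 0" using assms by (simp add: v_def)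
  then show ?thesis
    unfolding eq lattice_ideal_def ideal_generated_def
    by (intro mult_module.span_scale mult_module.span_base) auto
qed

lemma initial_exponents_lattice_ideal:
  "{initial_exponent p f | f :: ('n::{finite,linorder}, 'k::field) mpoly. f \<in> lattice_ideal p \<and> f \<noteq> 0} =
    nonminimal p"
proof (intro equalityI subsetI)
  fix m assume "m \<in> {initial_exponent p f | f :: ('n, 'k) mpoly. f \<in> lattice_ideal p \<and> f \<noteq> 0}"
  then obtain f :: "('n, 'k) mpoly" where f: "f \<in> lattice_ideal p" "f \<noteq> 0"
    and m: "m = initial_exponent p f" by blast
  show "m \<in> nonminimal p"
  proof (rule ccontr)
    assume "m \<notin> nonminimal p"
    \<comment> \<open>Any other key of the same degree would be smaller than \<open>m\<close> and
      witness that \<open>m\<close> is nonminimal. So the sum over this degree is the single nonzero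
      coefficient at \<open>m\<close>, although it must vanish on the ideal.\<close>
    then have "p_degree p (int_vec k) \<noteq> p_degree p (int_vec m)" if "k \<in> Poly_Mapping.keys f" "k \<noteq> m" for k
      using initial_exponent(2)[OF f(2)] that m by (auto simp: nonminimal_def)
    then have "degree_sum p (p_degree p (int_vec m)) f =
        (\<Sum>k\<in>Poly_Mapping.keys f. if k = m then Poly_Mapping.lookup f m else 0)"
      unfolding degree_sum_def by (intro sum.cong) auto
    also have "\<dots> = Poly_Mapping.lookup f m"
      using initial_exponent(1)[OF f(2)] m by simp
    finally show False
      using degree_sum_lattice_ideal[OF f(1)] initial_exponent(1)[OF f(2), of p] m
      by (simp add: in_keys_iff)
  qed
next
  fix m assume "m \<in> nonminimal p"
  then obtain u where u: "p_degree p (int_vec u) = p_degree p (int_vec m)" "term_less p u m"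
    by (auto simp: nonminimal_def)
  let ?f = "monomial m - monomial u :: ('n, 'k) mpoly"
  have "u \<noteq> m" using u term_less_irrefl by blast
  then have keys: "Poly_Mapping.keys ?f = {m, u}"
    by (auto simp: monomial_def in_keys_iff lookup_minus lookup_single when_def split: if_splits)
  then have "?f \<noteq> 0" by auto
  have "\<not> term_less p m u" using u term_less_trans[of p u m u] term_less_irrefl[of p u] by blast
  with keys \<open>?f \<noteq> 0\<close> \<open>u \<noteq> m\<close> have "initial_exponent p ?f = m"
    using initial_exponent(1)[of ?f p] initial_exponent(2)[of ?f m p] by auto
  with \<open>?f \<noteq> 0\<close> binomial_in_lattice_ideal[OF u(1)]
  show "m \<in> {initial_exponent p f | f :: ('n, 'k) mpoly. f \<in> lattice_ideal p \<and> f \<noteq> 0}"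
    by (intro CollectI exI[of _ ?f]) simp
qed

lemma initial_ideal_lattice_ideal_iff:
  fixes f :: "('n::{finite,linorder}, 'k::field) mpoly"
  shows "f \<in> initial_ideal p (lattice_ideal p) \<longleftrightarrow> Poly_Mapping.keys f \<subseteq> nonminimal p"
proof -
  have "{initial_monomial p f | f :: ('n, 'k) mpoly. f \<in> lattice_ideal p \<and> f \<noteq> 0} =
      monomial ` nonminimal p"
    unfolding initial_exponents_lattice_ideal[where ?'k = 'k, symmetric] initial_monomial_def by auto
  then show ?thesis
    unfolding initial_ideal_def
    by (auto simp: monomial_ideal_iff intro: nonminimal_upward)
qed

text \<open>The initial monomials of \<open>G\<close> generate the whole initial ideal, so
  reducibility does not depend on the choice of \<open>G\<close>.\<close>

lemma reducible_iff_nonminimal: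
  fixes G :: "('n::{finite,linorder}, 'k::field) mpoly set"
  assumes "groebner_basis p G (lattice_ideal p)"
  shows "(\<exists>g\<in>G. reducible_by p m g) \<longleftrightarrow> m \<in> nonminimal p"
proof -
  have *: "{initial_monomial p g | g. g \<in> G \<and> g \<noteq> 0} = monomial ` (initial_exponent p ` {g\<in>G. g \<noteq> 0})"
    by (auto simp: initial_monomial_def)
  have "(\<exists>g\<in>G. reducible_by p m g) \<longleftrightarrow>
      (monomial m :: ('n, 'k) mpoly) \<in> ideal_generated {initial_monomial p g | g. g \<in> G \<and> g \<noteq> 0}"
    unfolding * by (auto simp: monomial_ideal_iff reducible_by_def initial_monomial_def monomial_dvd_iff)
  also have "\<dots> \<longleftrightarrow> m \<in> nonminimal p"
    using assms by (simp add: groebner_basis_def initial_ideal_lattice_ideal_iff)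
  finally show ?thesis .
qed

subsection \<open>Maximal standard monomials\<close>

lemma first_index_le [simp]: "first_index \<le> i"
  by (simp add: first_index_def)

lemma p_degree_axis [simp]: "p_degree p (int_vec (axis i a)) = int a * int (p $ i)"
proof -
  have "(\<Sum>j\<in>UNIV. int (axis i a $ j) * int (p $ j)) = (\<Sum>j\<in>UNIV. if j = i then int a * int (p $ i) else 0)"
    by (intro sum.cong) (auto simp: axis_def)
  then show ?thesis by (simp add: p_degree_def int_vec_def)
qed

text \<open>The first variable is a nonzerodivisor modulo the initial ideal, since it is the cheapest
  one in the reverse lexicographic order.\<close>

lemma nonminimal_drop_first:
  fixes m :: "nat ^ 'n::{finite,linorder}"
  assumes "m \<in> nonminimal p"
  shows "(\<chi> i. if i = first_index then 0 else m $ i) \<in> nonminimal p"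
proof -
  let ?o = "first_index :: 'n"
  from assms obtain u i where u: "p_degree p (int_vec u) = p_degree p (int_vec m)"
    "u $ i > m $ i" "\<forall>j<i. u $ j = m $ j" by (auto simp: nonminimal_iff)
  define a where "a = axis ?o (m $ ?o)"
  \<comment> \<open>The deciding index is the first one or comes after it. Hence \<open>a\<close>
    can be subtracted from \<open>u\<close> as well as from \<open>m\<close> without
    truncation.\<close>
  have "u $ ?o \<ge> m $ ?o"
    using u first_index_le[of i] by (cases "i = ?o") (auto simp: le_less)
  then have "u - a + a = u" by (auto simp: a_def vec_eq_iff axis_def)
  moreover have "m - a + a = m" by (auto simp: a_def vec_eq_iff axis_def)
  ultimately have "p_degree p (int_vec (u - a + a)) = p_degree p (int_vec (m - a + a))"
    using u(1) by simp
  then have "p_degree p (int_vec (u - a)) = p_degree p (int_vec (m - a))" by simp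
  moreover have "(u - a) $ i > (m - a) $ i"
    using u(2) by (cases "i = ?o") (auto simp: a_def axis_def)
  moreover have "\<forall>j<i. (u - a) $ j = (m - a) $ j" using u(3) by simp
  ultimately have "m - a \<in> nonminimal p" unfolding nonminimal_iff by blast
  moreover have "m - a = (\<chi> i. if i = ?o then 0 else m $ i)"
    by (auto simp: a_def vec_eq_iff axis_def)
  ultimately show ?thesis by simp
qed

text \<open>This is the leading term of \<open>x\<^sub>i^p\<^sub>1 - x\<^sub>1^p\<^sub>i\<close>.\<close>

lemma axis_nonminimal:
  assumes "p $ i > 0" "i \<noteq> first_index"
  shows "axis i (p $ first_index) \<in> nonminimal p"
  unfolding nonminimal_iff
proof (intro exI conjI)
  show "p_degree p (int_vec (axis first_index (p $ i))) = p_degree p (int_vec (axis i (p $ first_index)))"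
    by simp
  show "axis first_index (p $ i) $ first_index > axis i (p $ first_index) $ first_index"
    using assms by (simp add: axis_def)
qed (use first_index_le leD in blast)

text \<open>Truncation is intended: the entry 0 at the first index stays 0, just as
  \<open>pos_part\<close> sends the entry -1 of a vector in \<open>M_set\<close> to 0.\<close>

definition lower :: "nat ^ 'n \<Rightarrow> nat ^ 'n"
  where "lower v = (\<chi> i. v $ i - 1)"

lemma add_ones_M_set:
  fixes G :: "('n::{finite,linorder}, 'k::field) mpoly set"
  assumes "groebner_basis p G (lattice_ideal p)"
  shows "add_ones ` M_set p G =
    {v. v $ first_index = 0 \<and> (\<forall>i. i \<noteq> first_index \<longrightarrow> 0 < v $ i) \<and>
      lower v \<notin> nonminimal p \<and> (\<forall>i. i \<noteq> first_index \<longrightarrow> lower v + axis i 1 \<in> nonminimal p)}"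
    (is "_ = ?D")
proof -
  note red = reducible_iff_nonminimal[OF assms]
  have M: "M_set p G = {c. c $ first_index = -1 \<and> (\<forall>i. i \<noteq> first_index \<longrightarrow> c $ i \<ge> 0) \<and>
      pos_part c \<notin> nonminimal p \<and> (\<forall>i. i \<noteq> first_index \<longrightarrow> pos_part (c + axis i 1) \<in> nonminimal p)}"
    unfolding M_set_def red[symmetric] by blast
  have low: "lower (add_ones c) = pos_part c" for c :: "int ^ 'n::{finite,linorder}"
    by (auto simp: lower_def add_ones_def pos_part_def vec_eq_iff)
  \<comment> \<open>The raised entry is nonnegative already, and the first entry is clipped to 0 on
    both sides.\<close>
  have up: "pos_part (c + axis i 1) = pos_part c + axis i 1"
    if "c $ first_index = -1" "\<forall>i. i \<noteq> first_index \<longrightarrow> c $ i \<ge> 0" "i \<noteq> first_index"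
    for c :: "int ^ 'n::{finite,linorder}" and i
    using that by (auto simp: pos_part_def axis_def vec_eq_iff nat_add_distrib)
  show ?thesis
  proof (intro equalityI subsetI)
    fix v assume "v \<in> add_ones ` M_set p G"
    then obtain c where v: "v = add_ones c" and c: "c \<in> M_set p G" by blast
    then show "v \<in> ?D"
      using up[of c] by (auto simp: M low) (auto simp: add_ones_def add_nonneg_pos)
  next
    fix v assume v: "v \<in> ?D"
    define c where "c = int_vec v - 1"
    have vc: "v = add_ones c" by (simp add: c_def add_ones_def int_vec_def vec_eq_iff)
    have c: "c $ first_index = -1" "\<forall>i. i \<noteq> first_index \<longrightarrow> c $ i \<ge> 0"
      using v by (auto simp: c_def int_vec_def Suc_le_eq)
    have "c \<in> M_set p G"
      using v c up[OF c] unfolding M by (auto simp: vc low)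
    with vc show "v \<in> add_ones ` M_set p G" by blast
  qed
qed

lemma finite_bounded_vec: "finite {v :: nat ^ 'n. \<forall>i. v $ i \<le> b}"
proof -
  have "v \<in> vec_lambda ` (UNIV \<rightarrow>\<^sub>E {..b})" if "\<forall>i. v $ i \<le> b" for v :: "nat ^ 'n"
    using that by (intro image_eqI[of _ _ "vec_nth v"]) auto
  then have "{v :: nat ^ 'n. \<forall>i. v $ i \<le> b} \<subseteq> vec_lambda ` (UNIV \<rightarrow>\<^sub>E {..b})" by blast
  then show ?thesis by (rule finite_subset) (simp add: finite_PiE)
qed

theorem proposition6:
  fixes p :: "nat ^ 'n::{finite,linorder}"
    and G :: "('n, 'k::field) mpoly set"
  assumes "\<And>i. p $ i > 0"
    and "(GCD i\<in>UNIV. p $ i) = 1"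
    and "groebner_basis p G (lattice_ideal p)"
  shows "irredundant_irreducible_decomposition
    (initial_ideal p (lattice_ideal p :: ('n, 'k) mpoly set)) (add_ones ` M_set p G)"
proof -
  let ?o = "first_index :: 'n"
  let ?U = "nonminimal p"
  define D where "D = {v. v $ ?o = 0 \<and> (\<forall>i. i \<noteq> ?o \<longrightarrow> 0 < v $ i) \<and>
      lower v \<notin> ?U \<and> (\<forall>i. i \<noteq> ?o \<longrightarrow> lower v + axis i 1 \<in> ?U)}"
  \<comment> \<open>A pure power of each later variable is an initial monomial. This bound makes
    both \<open>D\<close> and the search space \<open>W\<close> below finite.\<close>
  have bound: "w $ i < p $ ?o" if "w \<notin> ?U" "i \<noteq> ?o" for w i
  proof (rule ccontr)
    assume "\<not> w $ i < p $ ?o"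
    then have "axis i (p $ ?o) \<le> w" by (simp add: axis_le_iff)
    with that nonminimal_upward[OF axis_nonminimal[OF assms(1)]] show False by blast
  qed
  have "v $ i \<le> p $ ?o" if "v \<in> D" for v i
    using that bound[of "lower v" i] by (cases "i = ?o") (auto simp: D_def lower_def)
  then have "D \<subseteq> {v. \<forall>i. v $ i \<le> p $ ?o}" by blast
  then have finite_D: "finite D" using finite_bounded_vec finite_subset by blast
  have above: "in_irreducible v m" if "v \<in> D" "m \<in> ?U" for v m
  proof (rule ccontr)
    assume "\<not> in_irreducible v m"
    moreover have "0 < v $ i" if "i \<noteq> ?o" for i
      using that \<open>v \<in> D\<close> by (simp add: D_def)
    ultimately have "\<not> v $ i \<le> m $ i" if "i \<noteq> ?o" for i
      using that unfolding in_irreducible_def by blast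
    then have "m $ i \<le> v $ i - 1" if "i \<noteq> ?o" for i
      using that by fastforce
    \<comment> \<open>Failing \<open>in_irreducible\<close> bounds \<open>m\<close> only off the
      first index, where \<open>v\<close> has no generator; zeroing the first entry loses nothing by
      \<open>nonminimal_drop_first\<close>.\<close>
    then have "(\<chi> i. if i = ?o then 0 else m $ i) \<le> lower v"
      by (simp add: less_eq_vec_def lower_def)
    with nonminimal_drop_first[OF \<open>m \<in> ?U\<close>] have "lower v \<in> ?U" using nonminimal_upward by blast
    with \<open>v \<in> D\<close> show False by (simp add: D_def)
  qed
  have below: "\<exists>v\<in>D. \<not> in_irreducible v m" if "m \<notin> ?U" for m
  proof -
    define m' :: "nat ^ 'n::{finite,linorder}" where "m' = (\<chi> i. if i = ?o then 0 else m $ i)"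
    \<comment> \<open>A maximal element of \<open>W\<close> is a maximal standard exponent off the
      first coordinate, and adding one to its later entries gives the required member of
      \<open>D\<close>.\<close>
    define W where "W = {w. w $ ?o = 0 \<and> m' \<le> w \<and> w \<notin> ?U}"
    have "m' \<le> m" by (simp add: m'_def less_eq_vec_def)
    with that have "m' \<notin> ?U" using nonminimal_upward by blast
    then have "m' \<in> W" by (simp add: W_def m'_def)
    have "w $ i \<le> p $ ?o" if "w \<in> W" for w i
      using that bound[of w i] by (cases "i = ?o") (auto simp: W_def)
    then have "W \<subseteq> {v. \<forall>i. v $ i \<le> p $ ?o}" by blast
    then have "finite W" using finite_bounded_vec finite_subset by blast
    with \<open>m' \<in> W\<close> obtain w where w: "w \<in> W" and max: "\<And>x. x \<in> W \<Longrightarrow> w \<le> x \<Longrightarrow> x = w"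
      using finite_has_maximal[of W] by auto
    define v :: "nat ^ 'n::{finite,linorder}" where "v = (\<chi> i. if i = ?o then 0 else w $ i + 1)"
    have lv: "lower v = w" using w by (auto simp: lower_def v_def vec_eq_iff W_def)
    have "w + axis i 1 \<in> ?U" if "i \<noteq> ?o" for i
    proof (rule ccontr)
      assume "w + axis i 1 \<notin> ?U"
      moreover have "w \<le> w + axis i 1" by (simp add: less_eq_vec_def)
      ultimately have "w + axis i 1 = w"
        using w that by (intro max) (auto simp: W_def axis_def intro: order_trans)
      then show False by (metis add_cancel_right_right axis_eq_0_iff one_neq_zero)
    qed
    with w lv have "v \<in> D" by (auto simp: D_def W_def v_def)
    moreover have "\<not> in_irreducible v m"
      using w by (auto simp: in_irreducible_def v_def W_def m'_def less_eq_vec_def Suc_le_eq not_less split: if_splits)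
    ultimately show ?thesis by blast
  qed
  have "m \<in> ?U \<longleftrightarrow> (\<forall>v\<in>D. in_irreducible v m)" for m
    using above below by blast
  then have "irreducible_decomposition (initial_ideal p (lattice_ideal p :: ('n, 'k) mpoly set)) D"
    using finite_D
    by (auto simp: irreducible_decomposition_def initial_ideal_lattice_ideal_iff
        irreducible_ideal_iff subset_iff)
  moreover have "v = w" if "v \<in> D" "w \<in> D"
    "(irreducible_ideal v :: ('n, 'k) mpoly set) \<subseteq> irreducible_ideal w" for v w
  proof (rule ccontr)
    assume "v \<noteq> w"
    then obtain i where i: "v $ i \<noteq> w $ i" by (auto simp: vec_eq_iff)
    have "i \<noteq> ?o" using i that by (auto simp: D_def)
    have le: "w $ j \<le> v $ j" for j
      using that by (cases "j = ?o") (auto simp: D_def irreducible_ideal_subset_iff)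
    have "0 < w $ i" using \<open>w \<in> D\<close> \<open>i \<noteq> ?o\<close> by (auto simp: D_def)
    \<comment> \<open>Since \<open>w \<le> v\<close> with strict inequality at \<open>i\<close>,
      there is room for one more unit at \<open>i\<close>; nonminimality then passes up to
      \<open>lower v\<close>, a contradiction.\<close>
    with i le[of i] have "(lower w + axis i 1) $ j \<le> lower v $ j" for j
      using le[of j] by (auto simp: lower_def axis_def)
    then have "lower w + axis i 1 \<le> lower v" by (simp add: less_eq_vec_def)
    moreover have "lower w + axis i 1 \<in> ?U"
      using \<open>w \<in> D\<close> \<open>i \<noteq> ?o\<close> by (simp add: D_def)
    ultimately have "lower v \<in> ?U" by (rule nonminimal_upward[rotated])
    with \<open>v \<in> D\<close> show False by (simp add: D_def)
  qed
  ultimately show ?thesis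
    unfolding add_ones_M_set[OF assms(3)] D_def[symmetric]
    by (rule antichain_decomposition_irredundant)
qed

end
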